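(* Let $q$ be a prime power, $\mathbb{A}=\mathbb{F}_q[t]$, and let $f,g\in\mathbb{A}$ be non-constant polynomials. Let $g=\alpha P_1^{e_1}\cdots P_r^{e_r}$ be the prime factorization of $g$, where $\alpha\in\mathbb{F}_q^*$, each $e_i\ge 1$, and $P_1,\dots,P_r$ are pairwise distinct monic irreducible polynomials of positive degree over $\mathbb{F}_q$. Put $n=\deg f$ and $d_i=\deg P_i$ for $i=1,\dots,r$. Then the number $M(f,g)$ of congruence preserving functions from $\mathbb{A}_f$ to $\mathbb{A}_g$ is $$M(f,g)=\frac{|g|^{q^{n}}}{\prod_{i=1}^{r}|P_{i}|^{(q-1)\sum_{k=1}^{n-1}q^{k}\min\{e_{i},\lfloor k/d_{i}\rfloor\}}}.$$
   Context: $\mathbb{F}_q$ is the finite field with $q$ elements and $\mathbb{A}=\mathbb{F}_q[t]$. For non-zero $h\in\mathbb{A}$, $|h|=q^{\deg h}$. For a non-constant $f\in\mathbb{A}$, $\mathbb{A}_f=\mathbb{A}/f\mathbb{A}$ is the residue class ring modulo $f$, and $\mathcal{A}_f=\{h\in\mathbb{A}:\deg h<\deg f\}\cup\{0\}$, a complete set of representatives of the residue classes modulo $f$; for $h\in\mathcal{A}_f$, $\bar h$ denotes the residue class of $h$ modulo $f$. A function $\sigma:\mathbb{A}_f\to\mathbb{A}_g$ is called congruence preserving if for all $h_1,h_2\in\mathcal{A}_f$ and every $h\in\mathbb{A}$ dividing $g$, $h_1\equiv h_2\pmod h$ implies $\sigma(\bar h_1)\equiv\sigma(\bar h_2)\pmod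 h$ (here $h_1,h_2$ are regarded as elements of $\mathbb{A}$, and reduction modulo $h$ of elements of $\mathbb{A}_g$ is well defined since $h\mid g$). *)

theory Defs
  imports
    "HOL-Algebra.QuotRing"
    "HOL-Algebra.Algebraic_Closure_Type"
    "HOL-Number_Theory.Cong"
    "HOL-Library.FuncSet"
    "HOL-Library.Cardinality"
begin

abbreviation poly_ring_alg :: "'a::finite_field poly ring"
  where "poly_ring_alg \<equiv> ring_of_type_algebra"

definition residue_class_ring :: "'a::finite_field poly \<Rightarrow> 'a poly set ring"
  where "residue_class_ring f = poly_ring_alg Quot (PIdl\<^bsub>poly_ring_alg\<^esub> f)"

definition residue_class :: "'a::finite_field poly \<Rightarrow> 'a poly \<Rightarrow> 'a poly set"
  where "residue_class f h = (PIdl\<^bsub>poly_ring_alg\<^esub> f) +>\<^bsub>poly_ring_alg\<^esub> h"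

definition reduced_polys :: "'a::finite_field poly \<Rightarrow> 'a poly set"
  where "reduced_polys f = {h. Polynomial.degree h < Polynomial.degree f} \<union> {0}"

text \<open>Congruence modulo \<open>h\<close> of residue classes modulo a multiple \<open>g\<close> of \<open>h\<close>, tested on
  representatives; the lemma \<open>cong_classes_residue_class\<close> below states the independence of
  the choice of representatives.\<close>

definition cong_classes :: "'a::finite_field poly \<Rightarrow> 'a poly set \<Rightarrow> 'a poly set \<Rightarrow> bool"
  where "cong_classes h A B \<longleftrightarrow> (\<forall>u\<in>A. \<forall>v\<in>B. [u = v] (mod h))"

definition congruence_preserving ::
    "'a::finite_field poly \<Rightarrow> 'a poly \<Rightarrow> ('a poly set \<Rightarrow> 'a poly set) \<Rightarrow> bool"
  where "congruence_preserving f g \<sigma> \<longleftrightarrow>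
    (\<forall>h1\<in>reduced_polys f. \<forall>h2\<in>reduced_polys f. \<forall>h. h dvd g \<longrightarrow>
       [h1 = h2] (mod h) \<longrightarrow>
       cong_classes h (\<sigma> (residue_class f h1)) (\<sigma> (residue_class f h2)))"

text \<open>The extensional function space makes functions between the residue class rings
  correspond one to one to the HOL functions that are counted.\<close>

definition num_congruence_preserving :: "'a::finite_field poly \<Rightarrow> 'a poly \<Rightarrow> nat"
  where "num_congruence_preserving f g =
    card {\<sigma> \<in> carrier (residue_class_ring f) \<rightarrow>\<^sub>E carrier (residue_class_ring g).
            congruence_preserving f g \<sigma>}"

definition poly_abs :: "'a::finite_field poly \<Rightarrow> nat"
  where "poly_abs h = (if h = 0 then 0 else CARD('a) ^ Polynomial.degree h)"

lemma residue_class_eq: "residue_class f h = {x * f + h |x. True}"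
  by (auto simp: residue_class_def cgenideal_def a_r_coset_def r_coset_def
      ring_of_type_algebra_def)

lemma carrier_residue_class_ring: "carrier (residue_class_ring f) = range (residue_class f)"
  by (auto simp: residue_class_ring_def residue_class_def FactRing_def A_RCOSETS_def
      RCOSETS_def a_r_coset_def ring_of_type_algebra_def)

lemma cong_classes_residue_class:
  assumes "h dvd g"
  shows "cong_classes h (residue_class g u) (residue_class g v) \<longleftrightarrow> [u = v] (mod h)"
proof -
  have *: "(x * g + w) mod h = w mod h" for x w
    using assms by (metis dvd_mult mod_add_left_eq mod_0_imp_dvd dvd_imp_mod_0 add_0)
  show ?thesis
    unfolding cong_classes_def residue_class_eq by (auto simp: cong_def *)
qed

end

theory Submission
  imports Defs
begin

text \<open>
  On reduced representatives, a function is congruence preserving modulo \<open>g = m * P ^ (k + 1)\<close>, with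
  \<open>P\<close> irreducible not dividing \<open>m\<close>, iff it is so modulo \<open>m * P ^ k\<close> and respects congruence modulo
  \<open>P ^ (k + 1)\<close>. A function that is congruence preserving modulo \<open>m * P ^ k\<close> lifts to one modulo
  \<open>m * P ^ (k + 1)\<close> by a digit modulo \<open>P\<close> at each argument, which may be chosen freely at one
  argument in each class modulo \<open>P ^ (k + 1)\<close> and is then determined on the whole class. There are
  \<open>q ^ min ((k + 1) * deg P) n\<close> such classes, so that
  \<open>M(f, g) = (\<Prod>i. \<Prod>j = 1..e i. |P i| ^ q ^ min (j * d i) n)\<close>.
\<close>

section \<open>Reduced polynomials as representatives of residue classes\<close>

lemma mem_reduced_polys_iff: "u \<in> reduced_polys g \<longleftrightarrow> u mod g = u" if "g \<noteq> 0"
  using that degree_mod_less[of g u] mod_poly_less[of u g] by (auto simp: reduced_polys_def)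

lemma mod_in_reduced_polys: "g \<noteq> 0 \<Longrightarrow> u mod g \<in> reduced_polys g"
  by (simp add: mem_reduced_polys_iff)

lemma reduced_polys_eqI:
  assumes "g \<noteq> 0" "u \<in> reduced_polys g" "v \<in> reduced_polys g" "g dvd u - v"
  shows "u = v"
  using assms by (metis mem_reduced_polys_iff mod_eq_dvd_iff)

text \<open>Splitting off the constant coefficient with \<open>pCons\<close> gives a factor
  \<open>CARD('a)\<close> for each further coefficient. A constant \<open>g\<close> leaves only the
  zero polynomial, in agreement with exponent 0.\<close>

lemma
  fixes g :: "'a::finite_field poly"
  shows finite_reduced_polys: "finite (reduced_polys g)"
    and card_reduced_polys: "card (reduced_polys g) = CARD('a) ^ Polynomial.degree g"
proof -
  define L where "L n = {p :: 'a poly. \<forall>i\<ge>n. coeff p i = 0}" for n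
  have "finite (L n) \<and> card (L n) = CARD('a) ^ n" for n
  proof (induction n)
    case 0
    have "L 0 = {0}"
      by (auto simp: L_def poly_eq_iff)
    then show ?case by simp
  next
    case (Suc n)
    have "p \<in> (\<lambda>(a, p). pCons a p) ` (UNIV \<times> L n)" if "p \<in> L (Suc n)" for p
    proof (cases p)
      case (pCons a r)
      with that have "r \<in> L n" by (auto simp: L_def coeff_pCons split: nat.splits)
      with pCons show ?thesis by force
    qed
    then have "L (Suc n) = (\<lambda>(a, p). pCons a p) ` (UNIV \<times> L n)"
      by (auto simp: L_def coeff_pCons split: nat.splits)
    moreover have "inj_on (\<lambda>(a, p). pCons a p) (UNIV \<times> L n)"
      by (auto simp: inj_on_def)
    ultimately show ?case
      using Suc by (auto simp: card_image card_cartesian_product)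
  qed
  moreover have "reduced_polys g = L (Polynomial.degree g)"
  proof (intro equalityI subsetI)
    fix p assume "p \<in> L (Polynomial.degree g)"
    then show "p \<in> reduced_polys g"
      unfolding L_def reduced_polys_def
      by (metis (mono_tags, lifting) UnI1 UnI2 leading_coeff_0_iff linorder_not_le
          mem_Collect_eq singletonI)
  qed (auto simp: L_def reduced_polys_def coeff_eq_0)
  ultimately show "finite (reduced_polys g)"
    and "card (reduced_polys g) = CARD('a) ^ Polynomial.degree g"
    by simp_all
qed

text \<open>If \<open>Q\<close> has degree at most that of \<open>f\<close>, every remainder modulo
  \<open>Q\<close> is already reduced modulo \<open>f\<close> and so occurs; otherwise reduction
  modulo \<open>Q\<close> changes nothing. This is the origin of the minimum in the
  exponents.\<close>

lemma card_mod_image_reduced_polys: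
  fixes f Q :: "'a::finite_field poly"
  assumes "f \<noteq> 0" "Q \<noteq> 0"
  shows "card ((\<lambda>x. x mod Q) ` reduced_polys f) =
    CARD('a) ^ min (Polynomial.degree Q) (Polynomial.degree f)"
proof (cases "Polynomial.degree Q \<le> Polynomial.degree f")
  case True
  then have "reduced_polys Q \<subseteq> reduced_polys f"
    by (auto simp: reduced_polys_def)
  then have "(\<lambda>x. x mod Q) ` reduced_polys f = reduced_polys Q"
    using assms by (force simp: mod_in_reduced_polys mem_reduced_polys_iff)
  with True show ?thesis by (simp add: card_reduced_polys min_absorb1)
next
  case False
  then have "x mod Q = x" if "x \<in> reduced_polys f" for x
    using that by (auto simp: reduced_polys_def mod_poly_less)
  then have "(\<lambda>x. x mod Q) ` reduced_polys f = reduced_polys f"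
    by simp
  with False show ?thesis by (simp add: card_reduced_polys min_absorb2)
qed

section \<open>Congruence preserving functions on reduced representatives\<close>

text \<open>The domain is an arbitrary set \<open>S\<close>, because the lifting step uses only its
  finiteness and the number of residue classes that it meets.\<close>

definition cong_fun :: "'a::finite_field poly set \<Rightarrow> 'a poly \<Rightarrow> ('a poly \<Rightarrow> 'a poly) \<Rightarrow> bool"
  where "cong_fun S g \<sigma> \<longleftrightarrow>
    (\<forall>x\<in>S. \<forall>y\<in>S. \<forall>h. h dvd g \<longrightarrow> h dvd x - y \<longrightarrow> h dvd \<sigma> x - \<sigma> y)"

definition cong_funs :: "'a::finite_field poly set \<Rightarrow> 'a poly \<Rightarrow> ('a poly \<Rightarrow> 'a poly) set"
  where "cong_funs S g = {\<sigma> \<in> S \<rightarrow>\<^sub>E reduced_polys g. cong_fun S g \<sigma>}"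

lemma residue_class_eq_iff: "residue_class f x = residue_class f y \<longleftrightarrow> f dvd x - y"
proof
  assume "residue_class f x = residue_class f y"
  moreover have "x \<in> residue_class f x"
    unfolding residue_class_eq by (auto intro: exI[of _ 0])
  ultimately have "x \<in> residue_class f y" by simp
  then show "f dvd x - y"
    unfolding residue_class_eq by auto
next
  assume "f dvd x - y"
  then obtain c where c: "x = y + f * c"
    by (metis add.commute diff_add_cancel dvd_def)
  have "\<exists>b. a * f + x = b * f + y" for a
    by (rule exI[of _ "a + c"]) (simp add: c algebra_simps)
  moreover have "\<exists>b. a * f + y = b * f + x" for a
    by (rule exI[of _ "a - c"]) (simp add: c algebra_simps)
  ultimately show "residue_class f x = residue_class f y"
    unfolding residue_class_eq by auto
qed

lemma bij_betw_residue_class: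
  assumes "f \<noteq> 0"
  shows "bij_betw (residue_class f) (reduced_polys f) (carrier (residue_class_ring f))"
proof -
  have "residue_class f x \<in> residue_class f ` reduced_polys f" for x
    by (rule image_eqI[of _ _ "x mod f"])
      (use assms in \<open>auto simp: residue_class_eq_iff mod_in_reduced_polys mod_eq_dvd_iff [symmetric]\<close>)
  then show ?thesis
    using assms
    by (auto simp: bij_betw_def inj_on_def carrier_residue_class_ring residue_class_eq_iff
        intro: reduced_polys_eqI)
qed

text \<open>Residue classes are replaced by their reduced representatives in domain and codomain,
  through the inverses \<open>a\<close> and \<open>b\<close> of the two class maps. The congruence
  condition survives since every \<open>h\<close> in it divides \<open>g\<close>.\<close>

lemma num_congruence_preserving_eq:
  assumes "f \<noteq> 0" "g \<noteq> 0"
  shows "num_congruence_preserving f g = card (cong_funs (reduced_polys f) g)"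
proof -
  define a b where "a = inv_into (reduced_polys f) (residue_class f)"
    and "b = inv_into (reduced_polys g) (residue_class g)"
  note bij = bij_betw_residue_class[OF assms(1)] bij_betw_residue_class[OF assms(2)]
  have a: "a (residue_class f x) = x" if "x \<in> reduced_polys f" for x
    using bij(1) that unfolding a_def by (rule bij_betw_inv_into_left)
  have a': "residue_class f (a A) = A" "a A \<in> reduced_polys f"
    if "A \<in> carrier (residue_class_ring f)" for A
    using bij(1) that unfolding a_def
    by (auto simp: bij_betw_inv_into_right intro: bij_betw_apply[OF bij_betw_inv_into])
  have b: "b (residue_class g x) = x" if "x \<in> reduced_polys g" for x
    using bij(2) that unfolding b_def by (rule bij_betw_inv_into_left)
  have b': "residue_class g (b A) = A" "b A \<in> reduced_polys g"
    if "A \<in> carrier (residue_class_ring g)" for A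
    using bij(2) that unfolding b_def
    by (auto simp: bij_betw_inv_into_right intro: bij_betw_apply[OF bij_betw_inv_into])
  have carrier: "residue_class h x \<in> carrier (residue_class_ring h)" for h x :: "'a poly"
    by (simp add: carrier_residue_class_ring)
  let ?X = "{\<sigma> \<in> carrier (residue_class_ring f) \<rightarrow>\<^sub>E carrier (residue_class_ring g).
    congruence_preserving f g \<sigma>}"
  have "bij_betw (\<lambda>\<sigma>. \<lambda>x\<in>reduced_polys f. b (\<sigma> (residue_class f x)))
    ?X (cong_funs (reduced_polys f) g)"
  proof (rule bij_betw_byWitness[where f' =
        "\<lambda>\<tau>. \<lambda>A\<in>carrier (residue_class_ring f). residue_class g (\<tau> (a A))"])
    show "\<forall>\<sigma>\<in>?X. (\<lambda>A\<in>carrier (residue_class_ring f). residue_class g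
        ((\<lambda>x\<in>reduced_polys f. b (\<sigma> (residue_class f x))) (a A))) = \<sigma>"
    proof (intro ballI extensionalityI[OF restrict_extensional])
      fix \<sigma> A assume "\<sigma> \<in> ?X" and A: "A \<in> carrier (residue_class_ring f)"
      then have "\<sigma> A \<in> carrier (residue_class_ring g)" by (blast intro: PiE_mem)
      with A show "(\<lambda>A\<in>carrier (residue_class_ring f). residue_class g
        ((\<lambda>x\<in>reduced_polys f. b (\<sigma> (residue_class f x))) (a A))) A = \<sigma> A"
        by (simp add: a' b')
    qed (auto simp: PiE_def)
    show "\<forall>\<tau>\<in>cong_funs (reduced_polys f) g. (\<lambda>x\<in>reduced_polys f. b
        ((\<lambda>A\<in>carrier (residue_class_ring f). residue_class g (\<tau> (a A))) (residue_class f x))) = \<tau>"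
    proof (intro ballI extensionalityI[OF restrict_extensional])
      fix \<tau> x assume "\<tau> \<in> cong_funs (reduced_polys f) g" and x: "x \<in> reduced_polys f"
      then have "\<tau> x \<in> reduced_polys g" by (auto simp: cong_funs_def intro: PiE_mem)
      with x show "(\<lambda>x\<in>reduced_polys f. b ((\<lambda>A\<in>carrier (residue_class_ring f).
          residue_class g (\<tau> (a A))) (residue_class f x))) x = \<tau> x"
        by (simp add: a b carrier)
    qed (auto simp: cong_funs_def PiE_def)
    show "(\<lambda>\<sigma>. \<lambda>x\<in>reduced_polys f. b (\<sigma> (residue_class f x))) ` ?X
        \<subseteq> cong_funs (reduced_polys f) g"
    proof (rule image_subsetI)
      fix \<sigma> assume "\<sigma> \<in> ?X"
      then have \<sigma>: "\<And>A. A \<in> carrier (residue_class_ring f) \<Longrightarrow> \<sigma> A \<in> carrier (residue_class_ring g)"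
        and cp: "congruence_preserving f g \<sigma>"
        by (auto intro: PiE_mem)
      have "h dvd b (\<sigma> (residue_class f x)) - b (\<sigma> (residue_class f y))"
        if xy: "x \<in> reduced_polys f" "y \<in> reduced_polys f" "h dvd g" "h dvd x - y" for x y h
      proof -
        have "cong_classes h (\<sigma> (residue_class f x)) (\<sigma> (residue_class f y))"
          using cp xy by (simp add: congruence_preserving_def cong_iff_dvd_diff)
        \<comment> \<open>Each value is the class of its reduced representative, so congruence of
          classes can be read off from the representatives.\<close>
        moreover have "\<sigma> (residue_class f z) = residue_class g (b (\<sigma> (residue_class f z)))" for z
          by (simp add: \<sigma> b'(1) carrier)
        ultimately show ?thesis
          by (metis cong_classes_residue_class cong_iff_dvd_diff xy(3))
      qed
      then show "(\<lambda>x\<in>reduced_polys f. b (\<sigma> (residue_class f x))) \<in> cong_funs (reduced_polys f) g"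
        by (simp add: cong_funs_def cong_fun_def \<sigma> b'(2) carrier)
    qed
    show "(\<lambda>\<tau>. \<lambda>A\<in>carrier (residue_class_ring f). residue_class g (\<tau> (a A))) `
        cong_funs (reduced_polys f) g \<subseteq> ?X"
      by (auto simp: cong_funs_def cong_fun_def congruence_preserving_def carrier a
          cong_classes_residue_class cong_iff_dvd_diff)
  qed
  then show ?thesis
    unfolding num_congruence_preserving_def by (rule bij_betw_same_card)
qed

section \<open>Raising the exponent of one prime by one\<close>

text \<open>A divisor of \<open>m * P ^ Suc k\<close> either divides \<open>m * P ^ k\<close> or is
  \<open>P ^ Suc k\<close> times a divisor of \<open>m\<close>. In the second case the two factors
  are coprime, and the congruences modulo each of them combine.\<close>

lemma cong_fun_mult_prime_iff:
  assumes P: "prime_elem P" and m: "\<not> P dvd m"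
  shows "cong_fun S (m * P ^ Suc k) \<sigma> \<longleftrightarrow> cong_fun S (m * P ^ k) \<sigma> \<and>
    (\<forall>x\<in>S. \<forall>y\<in>S. P ^ Suc k dvd x - y \<longrightarrow> P ^ Suc k dvd \<sigma> x - \<sigma> y)"
    (is "?L \<longleftrightarrow> ?R")
proof
  assume L: ?L
  have "h dvd m * P ^ Suc k" if "h dvd m * P ^ k" for h
    using that by (metis dvd_mult2 mult.assoc power_Suc2)
  with L show ?R
    unfolding cong_fun_def by (auto simp del: power_Suc)
next
  assume R: ?R
  show ?L
    unfolding cong_fun_def
  proof (intro ballI allI impI)
    fix x y h
    assume xy: "x \<in> S" "y \<in> S" and h: "h dvd m * P ^ Suc k" and hxy: "h dvd x - y"
    have P0: "P \<noteq> 0" using P by auto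
    obtain c where c: "m * P ^ Suc k = h * c" using h by (elim dvdE)
    show "h dvd \<sigma> x - \<sigma> y"
    \<comment> \<open>The cofactor \<open>c\<close> of \<open>h\<close> decides between the two
      kinds of divisors: \<open>P\<close> divides \<open>c\<close> exactly if \<open>h\<close> still
      divides \<open>m * P ^ k\<close>.\<close>
    proof (cases "P dvd c")
      case True
      then obtain c' where "c = P * c'" by (elim dvdE)
      with c P0 have "m * P ^ k = h * c'" by (simp add: ac_simps)
      then have "h dvd m * P ^ k" by simp
      with R xy hxy show ?thesis unfolding cong_fun_def by blast
    next
      case False
      have "P ^ Suc k dvd c * h"
        using c by (metis dvd_triv_right mult.commute)
      then have "P ^ Suc k dvd h"
        using False P by (intro prime_power_dvd_multD[of P "Suc k" c h]) auto
      then obtain h' where h': "h = P ^ Suc k * h'" by (elim dvdE)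
      with c P0 have h'm: "m = h' * c" by (simp add: ac_simps)
      then have "h' dvd m * P ^ k" by (simp add: mult.assoc)
      moreover have "h' dvd x - y" "P ^ Suc k dvd x - y"
        using hxy h' by (auto elim: dvd_mult_left dvd_mult_right simp del: power_Suc)
      ultimately have "h' dvd \<sigma> x - \<sigma> y" and Q: "P ^ Suc k dvd \<sigma> x - \<sigma> y"
        using R xy unfolding cong_fun_def by blast+
      then obtain w where w: "\<sigma> x - \<sigma> y = h' * w" by (elim dvdE)
      \<comment> \<open>Since \<open>h'\<close> divides \<open>m\<close>, it is prime to
        \<open>P\<close>, so the full power of \<open>P\<close> must divide the cofactor
        \<open>w\<close>.\<close>
      have "\<not> P dvd h'" using m h'm by auto
      then have "P ^ Suc k dvd w"
        using P Q w by (intro prime_power_dvd_multD[of P "Suc k" h' w]) auto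
      with w h' show ?thesis by (simp add: mult.commute mult_dvd_mono del: power_Suc)
    qed
  qed
qed

text \<open>Supplies the top digit that a congruence modulo \<open>P ^ Suc k\<close> forces at an
  argument which is not a chosen representative.\<close>

lemma ex_reduced_linear_cong:
  fixes P m c :: "'a::finite_field poly"
  assumes P: "prime_elem P" and m: "\<not> P dvd m"
  shows "\<exists>w\<in>reduced_polys P. P dvd m * w + c"
proof -
  have P0: "P \<noteq> 0" using P by auto
  \<comment> \<open>Multiplication by \<open>m\<close> is injective on the finite residue field, hence surjective.\<close>
  let ?F = "\<lambda>w. (m * w) mod P"
  have "inj_on ?F (reduced_polys P)"
  proof (rule inj_onI)
    fix u v assume uv: "u \<in> reduced_polys P" "v \<in> reduced_polys P" "?F u = ?F v"
    then have "P dvd m * (u - v)" by (simp add: mod_eq_dvd_iff right_diff_distrib)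
    with P m have "P dvd u - v" by (auto simp: prime_elem_dvd_mult_iff)
    with uv P0 show "u = v" by (blast intro: reduced_polys_eqI)
  qed
  moreover have "?F ` reduced_polys P \<subseteq> reduced_polys P"
    using P0 by (auto intro: mod_in_reduced_polys)
  ultimately have "?F ` reduced_polys P = reduced_polys P"
    by (simp add: finite_reduced_polys endo_inj_surj)
  moreover have "- c mod P \<in> reduced_polys P"
    using P0 by (rule mod_in_reduced_polys)
  ultimately obtain w where "w \<in> reduced_polys P" "- c mod P = (m * w) mod P"
    by blast
  then have "w \<in> reduced_polys P" "P dvd m * w + c"
    by (metis, metis diff_minus_eq_add mod_eq_dvd_iff)
  then show ?thesis by blast
qed

text \<open>Subtracting the remainder does not raise the degree, so a nonzero quotient has degree at
  most that of \<open>u\<close> minus that of \<open>G\<close>. This bounds the top digit of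
  \<open>u\<close>.\<close>

lemma div_in_reduced_polys:
  assumes "G \<noteq> 0" "P \<noteq> 0" "u \<in> reduced_polys (G * P)"
  shows "u div G \<in> reduced_polys P"
proof (cases "u div G = 0")
  case False
  then have u: "u \<noteq> 0" by auto
  have "\<not> Polynomial.degree u < Polynomial.degree G"
    using False by (auto simp: div_poly_less)
  have "Polynomial.degree (u div G) + Polynomial.degree G = Polynomial.degree (u - u mod G)"
    using False assms(1) by (simp add: minus_mod_eq_div_mult degree_mult_eq)
  also have "\<dots> \<le> Polynomial.degree u"
    using degree_mod_less[OF assms(1), of u] \<open>\<not> Polynomial.degree u < Polynomial.degree G\<close>
    by (intro degree_diff_le) auto
  finally show ?thesis
    using assms u by (auto simp: reduced_polys_def degree_mult_eq)
qed (simp add: reduced_polys_def)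

lemma add_mult_in_reduced_polys:
  assumes "G \<noteq> 0" "P \<noteq> 0" "u \<in> reduced_polys G" "w \<in> reduced_polys P"
  shows "u + G * w \<in> reduced_polys (G * P)"
proof (cases "w = 0")
  case True
  with assms show ?thesis by (auto simp: reduced_polys_def degree_mult_eq)
next
  case False
  \<comment> \<open>A nonzero \<open>w\<close> forces \<open>P\<close> to have positive degree.
    Hence the degree of \<open>u\<close> is below that of \<open>G * P\<close> even if
    \<open>G\<close> is constant and \<open>u = 0\<close>.\<close>
  with assms(4) have "Polynomial.degree w < Polynomial.degree P"
    by (auto simp: reduced_polys_def)
  with assms False have "Polynomial.degree u < Polynomial.degree (G * P)"
      "Polynomial.degree (G * w) < Polynomial.degree (G * P)"
    by (auto simp: reduced_polys_def degree_mult_eq)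
  then show ?thesis by (auto simp: reduced_polys_def intro: degree_add_less)
qed

text \<open>The exponent counts the arguments with a free top digit. The count rests on a bijection
  \<open>\<Phi>\<close> onto the pairs of a congruence preserving function modulo
  \<open>G = m * P ^ k\<close> and an arbitrary choice of these digits.\<close>

lemma card_cong_funs_mult_prime:
  fixes P m :: "'a::finite_field poly"
  assumes P: "prime_elem P" and m: "\<not> P dvd m" and S: "finite S"
  shows "card (cong_funs S (m * P ^ Suc k)) =
    card (cong_funs S (m * P ^ k)) * card (reduced_polys P) ^ card ((\<lambda>x. x mod P ^ Suc k) ` S)"
proof -
  define G Q where "G = m * P ^ k" and "Q = P ^ Suc k"
  have P0: "P \<noteq> 0" using P by auto
  moreover from m have "m \<noteq> 0" by auto
  ultimately have G0: "G \<noteq> 0" by (simp add: G_def)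
  have GP: "m * P ^ Suc k = G * P" by (simp add: G_def ac_simps)
  \<comment> \<open>For elements divisible by \<open>P ^ k\<close>, divisibility by \<open>Q\<close>
    is a condition modulo \<open>P\<close> only.\<close>
  have Q_dvd_iff: "Q dvd P ^ k * z \<longleftrightarrow> P dvd z" for z
    using P0 by (simp add: Q_def mult.commute[of P])
  have iff: "cong_fun S (G * P) \<sigma> \<longleftrightarrow> cong_fun S G \<sigma> \<and>
      (\<forall>x\<in>S. \<forall>y\<in>S. Q dvd x - y \<longrightarrow> Q dvd \<sigma> x - \<sigma> y)" for \<sigma>
    using cong_fun_mult_prime_iff[OF P m, of S k \<sigma>] by (simp only: GP G_def Q_def)
  have "\<exists>R\<subseteq>S. inj_on (\<lambda>x. x mod Q) R \<and> (\<lambda>x. x mod Q) ` S = (\<lambda>x. x mod Q) ` R"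
    by (simp flip: subset_image_inj)
  then obtain R where R: "R \<subseteq> S" "inj_on (\<lambda>x. x mod Q) R"
      "(\<lambda>x. x mod Q) ` S = (\<lambda>x. x mod Q) ` R"
    by blast
  have "\<exists>y\<in>R. Q dvd x - y" if "x \<in> S" for x
    using that R(3) by (metis (no_types, lifting) imageE imageI mod_eq_dvd_iff)
  then obtain \<rho> where \<rho>: "\<And>x. x \<in> S \<Longrightarrow> \<rho> x \<in> R \<and> Q dvd x - \<rho> x"
    by metis
  have \<rho>_eq: "\<rho> x = y" if "x \<in> S" "y \<in> R" "Q dvd x - y" for x y
  proof -
    have "Q dvd (x - y) - (x - \<rho> x)" using that \<rho> by (blast intro: dvd_diff)
    then show ?thesis
      using R(2) that \<rho> by (auto simp: inj_on_def mod_eq_dvd_iff)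
  qed
  \<comment> \<open>\<open>R\<close> contains one representative of each class modulo \<open>Q\<close> met by \<open>S\<close>. The reduction modulo \<open>G\<close>
    and the top digits on \<open>R\<close> determine \<open>\<sigma>\<close>: the congruences modulo \<open>Q\<close> force all other top digits.\<close>
  define \<Phi> where "\<Phi> \<sigma> = (\<lambda>x\<in>S. \<sigma> x mod G, \<lambda>x\<in>R. \<sigma> x div G)" for \<sigma> :: "'a poly \<Rightarrow> 'a poly"
  have split: "\<sigma> x = \<sigma> x mod G + G * (\<sigma> x div G)" for \<sigma> :: "'a poly \<Rightarrow> 'a poly" and x
    by simp
  \<comment> \<open>Changing values by multiples of \<open>G\<close> does not affect the congruences
    modulo divisors of \<open>G\<close>. This serves both for reducing values modulo
    \<open>G\<close> and for adding top digits.\<close>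
  have cong_G: "cong_fun S G \<tau>" if "cong_fun S G \<sigma>" "\<And>x. x \<in> S \<Longrightarrow> G dvd \<sigma> x - \<tau> x" for \<sigma> \<tau>
    unfolding cong_fun_def
  proof (intro ballI allI impI)
    fix x y h assume *: "x \<in> S" "y \<in> S" "h dvd G" "h dvd x - y"
    then have "h dvd (\<sigma> x - \<sigma> y) - (\<sigma> x - \<tau> x) + (\<sigma> y - \<tau> y)"
      using that unfolding cong_fun_def by (meson dvd_add dvd_diff dvd_trans)
    then show "h dvd \<tau> x - \<tau> y" by simp
  qed
  have inj: "inj_on \<Phi> (cong_funs S (G * P))"
  proof (rule inj_onI)
    fix \<sigma> \<tau> assume \<sigma>: "\<sigma> \<in> cong_funs S (G * P)" and \<tau>: "\<tau> \<in> cong_funs S (G * P)"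
      and eq: "\<Phi> \<sigma> = \<Phi> \<tau>"
    have mod_eq: "\<sigma> x mod G = \<tau> x mod G" if "x \<in> S" for x
      using eq that by (auto simp: \<Phi>_def fun_eq_iff restrict_def split: if_splits)
    have div_eq: "\<sigma> x div G = \<tau> x div G" if "x \<in> R" for x
      using eq that by (auto simp: \<Phi>_def fun_eq_iff restrict_def split: if_splits)
    show "\<sigma> = \<tau>"
    proof (rule PiE_ext[of \<sigma> S "\<lambda>_. reduced_polys (G * P)"])
      fix x assume x: "x \<in> S"
      then have r: "\<rho> x \<in> S" "\<rho> x \<in> R" "Q dvd x - \<rho> x" using \<rho> R by auto
      have "\<sigma> (\<rho> x) = \<tau> (\<rho> x)"
        using split[of \<sigma> "\<rho> x"] split[of \<tau> "\<rho> x"] mod_eq[OF r(1)] div_eq[OF r(2)] by metis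
      moreover have "Q dvd \<sigma> x - \<sigma> (\<rho> x)" "Q dvd \<tau> x - \<tau> (\<rho> x)"
        using \<sigma> \<tau> x r by (auto simp: cong_funs_def iff)
      ultimately have "Q dvd \<sigma> x - \<tau> x"
        by (metis (no_types, lifting) diff_diff_eq2 diff_add_cancel dvd_diff)
      \<comment> \<open>The remainders modulo \<open>G\<close> agree, so only the digits differ. As
        \<open>P\<close> does not divide \<open>m\<close>, the digits are congruent modulo
        \<open>P\<close>, and being reduced they are equal.\<close>
      also have "\<sigma> x - \<tau> x = P ^ k * (m * (\<sigma> x div G - \<tau> x div G))"
        using split[of \<sigma> x] split[of \<tau> x] mod_eq[OF x]
        by (metis (no_types, lifting) G_def add_diff_cancel_left mult.assoc mult.commute right_diff_distrib)
      finally have "P dvd \<sigma> x div G - \<tau> x div G"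
        using P m by (simp add: Q_dvd_iff prime_elem_dvd_mult_iff)
      moreover have "\<sigma> x div G \<in> reduced_polys P" "\<tau> x div G \<in> reduced_polys P"
        using \<sigma> \<tau> x G0 P0 by (auto simp: cong_funs_def intro!: div_in_reduced_polys)
      ultimately have "\<sigma> x div G = \<tau> x div G"
        using P0 by (blast intro: reduced_polys_eqI)
      then show "\<sigma> x = \<tau> x"
        using split[of \<sigma> x] split[of \<tau> x] mod_eq[OF x] by metis
    qed (use \<sigma> \<tau> in \<open>auto simp: cong_funs_def\<close>)
  qed
  have sub: "\<Phi> ` cong_funs S (G * P) \<subseteq> cong_funs S G \<times> (R \<rightarrow>\<^sub>E reduced_polys P)"
  proof (rule image_subsetI)
    fix \<sigma> assume \<sigma>: "\<sigma> \<in> cong_funs S (G * P)"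
    then have "\<sigma> x div G \<in> reduced_polys P" if "x \<in> S" for x
      using that G0 P0 by (auto simp: cong_funs_def intro!: div_in_reduced_polys)
    moreover have "cong_fun S G (\<lambda>x\<in>S. \<sigma> x mod G)"
      by (rule cong_G[of \<sigma>]) (use \<sigma> in \<open>auto simp: cong_funs_def iff minus_mod_eq_mult_div\<close>)
    ultimately show "\<Phi> \<sigma> \<in> cong_funs S G \<times> (R \<rightarrow>\<^sub>E reduced_polys P)"
      using R(1) G0 by (auto simp: \<Phi>_def cong_funs_def mod_in_reduced_polys)
  qed
  have sur: "cong_funs S G \<times> (R \<rightarrow>\<^sub>E reduced_polys P) \<subseteq> \<Phi> ` cong_funs S (G * P)"
  proof (rule subsetI, clarify)
    fix s t assume s: "s \<in> cong_funs S G" and t: "t \<in> R \<rightarrow>\<^sub>E reduced_polys P"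
    have s_red: "s x \<in> reduced_polys G" if "x \<in> S" for x
      using s that by (auto simp: cong_funs_def)
    \<comment> \<open>The digit \<open>w\<close> is \<open>t x\<close> on \<open>R\<close>;
      elsewhere it must make the lifted value at \<open>x\<close> congruent modulo \<open>Q\<close>
      to the one at \<open>\<rho> x\<close>.\<close>
    have "\<exists>w. w \<in> reduced_polys P \<and> (x \<in> R \<longrightarrow> w = t x) \<and>
        Q dvd s x + G * w - (s (\<rho> x) + G * t (\<rho> x))" if x: "x \<in> S" for x
    proof (cases "x \<in> R")
      case True
      then have "\<rho> x = x" using \<rho>_eq[OF x True] by simp
      with True t show ?thesis by auto
    next
      case False
      have r: "\<rho> x \<in> S" "Q dvd x - \<rho> x" using \<rho>[OF x] R by auto
      \<comment> \<open>Because \<open>P ^ k\<close> divides \<open>G\<close>, the function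
        \<open>s\<close> respects congruence modulo \<open>P ^ k\<close>. Cancelling this power
        leaves a linear congruence for \<open>w\<close> modulo \<open>P\<close> with leading
        coefficient \<open>m\<close>.\<close>
      have "P ^ k dvd Q" by (simp add: Q_def)
      with r(2) have "P ^ k dvd x - \<rho> x" by (blast intro: dvd_trans)
      moreover have "P ^ k dvd G" by (simp add: G_def)
      ultimately have "P ^ k dvd s x - s (\<rho> x)"
        using s x r(1) by (simp add: cong_funs_def cong_fun_def)
      then obtain c where c: "s x - s (\<rho> x) = P ^ k * c" by (elim dvdE)
      obtain w where w: "w \<in> reduced_polys P" "P dvd m * w + (c - m * t (\<rho> x))"
        using ex_reduced_linear_cong[OF P m] by blast
      have "s x + G * w - (s (\<rho> x) + G * t (\<rho> x)) = (s x - s (\<rho> x)) + G * w - G * t (\<rho> x)"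
        by simp
      also have "\<dots> = P ^ k * (m * w + (c - m * t (\<rho> x)))"
        unfolding c G_def by (simp add: algebra_simps)
      finally show ?thesis
        using w False Q_dvd_iff by metis
    qed
    then obtain w where w: "\<And>x. x \<in> S \<Longrightarrow> w x \<in> reduced_polys P"
        "\<And>x. x \<in> S \<Longrightarrow> x \<in> R \<Longrightarrow> w x = t x"
        "\<And>x. x \<in> S \<Longrightarrow> Q dvd s x + G * w x - (s (\<rho> x) + G * t (\<rho> x))"
      by metis
    define \<sigma> where "\<sigma> = (\<lambda>x\<in>S. s x + G * w x)"
    have "cong_fun S G \<sigma>"
      by (rule cong_G[of s]) (use s in \<open>auto simp: cong_funs_def \<sigma>_def\<close>)
    moreover have "Q dvd \<sigma> x - \<sigma> y" if xy: "x \<in> S" "y \<in> S" "Q dvd x - y" for x y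
    proof -
      \<comment> \<open>Congruent arguments share their representative, so both lifted values are
        congruent to the one value there.\<close>
      have "Q dvd (x - y) + (y - \<rho> y)" using xy \<rho> by (blast intro: dvd_add)
      then have "\<rho> x = \<rho> y" using xy \<rho> by (intro \<rho>_eq) auto
      then have "Q dvd (s x + G * w x - (s (\<rho> x) + G * t (\<rho> x))) - (s y + G * w y - (s (\<rho> x) + G * t (\<rho> x)))"
        using w(3)[OF xy(1)] w(3)[OF xy(2)] by (metis dvd_diff)
      also have "(s x + G * w x - (s (\<rho> x) + G * t (\<rho> x))) - (s y + G * w y - (s (\<rho> x) + G * t (\<rho> x))) = \<sigma> x - \<sigma> y"
        using xy by (simp add: \<sigma>_def)
      finally show ?thesis .
    qed
    moreover have "\<sigma> \<in> S \<rightarrow>\<^sub>E reduced_polys (G * P)"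
      using w(1) s_red G0 P0 by (auto simp: \<sigma>_def intro: add_mult_in_reduced_polys)
    ultimately have "\<sigma> \<in> cong_funs S (G * P)"
      by (simp add: cong_funs_def iff)
    moreover have "\<Phi> \<sigma> = (s, t)"
    proof -
      have s_mod: "s x mod G = s x" if "x \<in> S" for x
        using s_red[OF that] G0 by (simp add: mem_reduced_polys_iff)
      moreover from this have "s x div G = 0" if "x \<in> S" for x
        using that G0 by (metis div_mult_mod_eq mod_div_trivial)
      \<comment> \<open>Outside their domains the components of \<open>\<Phi> \<sigma>\<close> take
        the value \<open>undefined\<close>, and so must \<open>s\<close> and
        \<open>t\<close>.\<close>
      moreover have "s x = undefined" if "x \<notin> S" for x
        using s that by (auto simp: cong_funs_def)
      moreover have "t x = undefined" if "x \<notin> R" for x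
        using t that by auto
      ultimately show ?thesis
        using G0 R(1) w(2) by (auto simp: \<Phi>_def \<sigma>_def fun_eq_iff)
    qed
    ultimately show "(s, t) \<in> \<Phi> ` cong_funs S (G * P)" by (metis image_eqI)
  qed
  have "bij_betw \<Phi> (cong_funs S (G * P)) (cong_funs S G \<times> (R \<rightarrow>\<^sub>E reduced_polys P))"
    using inj sub sur by (auto simp: bij_betw_def)
  moreover have "finite R" using S R(1) by (rule rev_finite_subset)
  ultimately show ?thesis
    unfolding GP unfolding G_def [symmetric] Q_def [symmetric] R(3)
    by (simp add: R(2) bij_betw_same_card card_cartesian_product card_PiE card_image)
qed

section \<open>The count as a product over prime powers\<close>

lemma card_cong_funs_mult_prime_power:
  fixes P m f :: "'a::finite_field poly"
  assumes P: "prime_elem P" and m: "\<not> P dvd m" and f: "f \<noteq> 0"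
  shows "card (cong_funs (reduced_polys f) (m * P ^ k)) = card (cong_funs (reduced_polys f) m) *
    (\<Prod>j\<in>{1..k}. poly_abs P ^ CARD('a) ^ min (j * Polynomial.degree P) (Polynomial.degree f))"
proof (induction k)
  case (Suc k)
  from P have "P \<noteq> 0" by auto
  with f show ?case
    using card_cong_funs_mult_prime[OF P m, of "reduced_polys f" k] Suc
    by (simp add: card_mod_image_reduced_polys finite_reduced_polys card_reduced_polys poly_abs_def
        degree_power_eq degree_mult_eq del: power_Suc flip: power_Suc)
qed simp

text \<open>Zero is the only reduced polynomial modulo a constant, which forces every value. This
  starts the induction over the prime factors.\<close>

lemma card_cong_funs_const:
  fixes \<alpha> :: "'a::finite_field"
  shows "card (cong_funs S [:\<alpha>:]) = 1"
proof -
  have "cong_funs S [:\<alpha>:] = S \<rightarrow>\<^sub>E {0}"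
    by (auto simp: cong_funs_def cong_fun_def reduced_polys_def PiE_mem)
  then show ?thesis by simp
qed

lemma card_cong_funs_prod:
  fixes P :: "'i \<Rightarrow> 'a::finite_field poly"
  assumes "finite I" and "\<alpha> \<noteq> 0" and f: "f \<noteq> 0"
    and P: "\<And>i. i \<in> I \<Longrightarrow> prime_elem (P i)"
    and ndvd: "\<And>i j. i \<in> I \<Longrightarrow> j \<in> I \<Longrightarrow> i \<noteq> j \<Longrightarrow> \<not> P i dvd P j"
  shows "card (cong_funs (reduced_polys f) (Polynomial.smult \<alpha> (\<Prod>i\<in>I. P i ^ e i))) =
    (\<Prod>i\<in>I. \<Prod>j\<in>{1..e i}.
      poly_abs (P i) ^ CARD('a) ^ min (j * Polynomial.degree (P i)) (Polynomial.degree f))"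
  using assms(1) P ndvd
proof (induction I rule: finite_induct)
  case empty
  show ?case by (simp add: card_cong_funs_const)
next
  case (insert i I)
  have "\<not> P i dvd P j" if "j \<in> I" for j
    using insert that by auto
  moreover have "prime_elem (P i)" using insert by simp
  \<comment> \<open>An inner induction over subsets \<open>J\<close> of \<open>I\<close> keeps the
    non-divisibility facts for \<open>I\<close> fixed; the empty product is excluded since a prime
    is not a unit.\<close>
  ultimately have "\<not> P i dvd (\<Prod>j\<in>J. P j ^ e j)" if "J \<subseteq> I" for J
    using that
    by (induction J rule: infinite_finite_induct)
      (auto simp: prime_elem_dvd_mult_iff dest: prime_elem_dvd_power prime_elem_not_unit)
  then have "\<not> P i dvd (\<Prod>j\<in>I. P j ^ e j)" by simp
  then have "\<not> P i dvd Polynomial.smult \<alpha> (\<Prod>j\<in>I. P j ^ e j)"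
    using \<open>\<alpha> \<noteq> 0\<close> by (simp add: dvd_smult_iff)
  then have "card (cong_funs (reduced_polys f)
        (Polynomial.smult \<alpha> (\<Prod>j\<in>I. P j ^ e j) * P i ^ e i)) =
      card (cong_funs (reduced_polys f) (Polynomial.smult \<alpha> (\<Prod>j\<in>I. P j ^ e j))) *
      (\<Prod>j\<in>{1..e i}.
        poly_abs (P i) ^ CARD('a) ^ min (j * Polynomial.degree (P i)) (Polynomial.degree f))"
    using insert.prems f by (intro card_cong_funs_mult_prime_power) auto
  moreover have "Polynomial.smult \<alpha> (\<Prod>j\<in>insert i I. P j ^ e j) =
      Polynomial.smult \<alpha> (\<Prod>j\<in>I. P j ^ e j) * P i ^ e i"
    using insert.hyps by (simp add: mult.commute)
  ultimately show ?case
    using insert by (simp add: mult.commute)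
qed

section \<open>Comparison of the exponents\<close>

text \<open>For \<open>a \<le> n\<close> this is the geometric sum of \<open>q ^ k\<close> from
  \<open>a\<close> to \<open>n - 1\<close>; otherwise all summands vanish and the minimum is
  \<open>n\<close>.\<close>

lemma power_min_add_sum:
  fixes q :: nat
  assumes "q \<ge> 1" "a \<ge> 1"
  shows "q ^ min a n + (q - 1) * (\<Sum>k\<in>{1..<n}. if a \<le> k then q ^ k else 0) = q ^ n"
proof (induction n)
  case (Suc n)
  show ?case
  proof (cases "a \<le> n")
    case True
    with assms Suc have "q ^ a + (q - 1) * (\<Sum>k\<in>{1..<n}. if a \<le> k then q ^ k else 0) = q ^ n"
      by (simp add: min_absorb1)
    moreover have "{1..<Suc n} = insert n {1..<n}"
      using True assms by auto
    \<comment> \<open>Writing \<open>q\<close> as a successor removes the truncated subtraction in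
      \<open>q - 1\<close>.\<close>
    moreover obtain p where "q = Suc p"
      using assms(1) by (cases q) auto
    ultimately show ?thesis
      using True by (simp add: min_absorb1 distrib_left)
  next
    case False
    then have "(\<Sum>k\<in>{1..<Suc n}. if a \<le> k then q ^ k else 0) = 0"
      by (intro sum.neutral) auto
    moreover have "min a (Suc n) = Suc n"
      using False by simp
    ultimately show ?thesis by simp
  qed
qed simp

text \<open>The number \<open>min e (k div d)\<close> counts the \<open>j\<close> in
  \<open>{1..e}\<close> with \<open>j * d \<le> k\<close>, so the claim is the preceding identity
  with \<open>a = j * d\<close>, summed over \<open>j\<close>.\<close>

lemma sum_power_min_add:
  fixes q d :: nat
  assumes "q \<ge> 1" "d \<ge> 1"
  shows "(\<Sum>j\<in>{1..e}. q ^ min (j * d) n) + (q - 1) * (\<Sum>k\<in>{1..<n}. q ^ k * min e (k div d))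
    = e * q ^ n"
proof (induction e)
  case (Suc e)
  have "q ^ k * min (Suc e) (k div d) = q ^ k * min e (k div d) + (if Suc e * d \<le> k then q ^ k else 0)" for k
    using less_eq_div_iff_mult_less_eq[of d "Suc e" k] assms(2) by (auto simp: min_def)
  then have "(\<Sum>k\<in>{1..<n}. q ^ k * min (Suc e) (k div d)) = (\<Sum>k\<in>{1..<n}. q ^ k * min e (k div d)) +
      (\<Sum>k\<in>{1..<n}. if Suc e * d \<le> k then q ^ k else 0)"
    by (simp only: sum.distrib)
  moreover have "q ^ min (Suc e * d) n + (q - 1) * (\<Sum>k\<in>{1..<n}. if Suc e * d \<le> k then q ^ k else 0) = q ^ n"
    using assms by (intro power_min_add_sum) auto
  ultimately show ?case
    using Suc by (simp add: distrib_left del: mult_Suc) simp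
qed simp

section \<open>Multiplicativity of the absolute value\<close>

lemma poly_abs_1: "poly_abs 1 = 1"
  by (simp add: poly_abs_def)

lemma poly_abs_mult: "poly_abs (p * r) = poly_abs p * poly_abs r"
  by (simp add: poly_abs_def degree_mult_eq power_add)

lemma poly_abs_smult: "c \<noteq> 0 \<Longrightarrow> poly_abs (Polynomial.smult c p) = poly_abs p"
  by (simp add: poly_abs_def)

lemma poly_abs_power: "poly_abs (p ^ k) = poly_abs p ^ k"
  by (induction k) (simp_all add: poly_abs_1 poly_abs_mult)

lemma poly_abs_prod: "poly_abs (\<Prod>i\<in>I. p i) = (\<Prod>i\<in>I. poly_abs (p i))"
  by (induction I rule: infinite_finite_induct) (simp_all add: poly_abs_1 poly_abs_mult)

lemma poly_abs_eq_0_iff: "poly_abs p = 0 \<longleftrightarrow> p = 0"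
  by (simp add: poly_abs_def)

theorem theorem1p5:
  fixes f g :: "'a::finite_field poly"
    and \<alpha> :: 'a
    and P :: "nat \<Rightarrow> 'a poly"
    and e d :: "nat \<Rightarrow> nat"
    and q n r :: nat
  assumes q: "q = CARD('a)"
    and f: "Polynomial.degree f > 0"
    and g: "Polynomial.degree g > 0"
    and factorization: "g = Polynomial.smult \<alpha> (\<Prod>i\<in>{1..r}. P i ^ e i)"
    and \<alpha>: "\<alpha> \<noteq> 0"
    and e: "\<And>i. i \<in> {1..r} \<Longrightarrow> e i \<ge> 1"
    and monic: "\<And>i. i \<in> {1..r} \<Longrightarrow> Polynomial.lead_coeff (P i) = 1"
    and irreducible: "\<And>i. i \<in> {1..r} \<Longrightarrow> Factorial_Ring.irreducible (P i)"
    and pos_degree: "\<And>i. i \<in> {1..r} \<Longrightarrow> Polynomial.degree (P i) > 0"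
    and distinct: "inj_on P {1..r}"
    and n: "n = Polynomial.degree f"
    and d: "\<And>i. i \<in> {1..r} \<Longrightarrow> d i = Polynomial.degree (P i)"
  shows "real (num_congruence_preserving f g) =
    real (poly_abs g ^ (q ^ n)) /
    real (\<Prod>i\<in>{1..r}. poly_abs (P i) ^ ((q - 1) * (\<Sum>k\<in>{1..n - 1}. q ^ k * min (e i) (k div d i))))"
proof -
  define E where "E i = (q - 1) * (\<Sum>k\<in>{1..n - 1}. q ^ k * min (e i) (k div d i))" for i
  have P: "prime_elem (P i)" if "i \<in> {1..r}" for i
    using irreducible[OF that] by (rule field_poly_irreducible_imp_prime)
  \<comment> \<open>Irreducibles that divide one another differ by a unit; for monic ones this unit
    is 1, against the distinctness of the \<open>P i\<close>.\<close>
  have ndvd: "\<not> P i dvd P j" if "i \<in> {1..r}" "j \<in> {1..r}" "i \<noteq> j" for i j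
  proof
    assume "P i dvd P j"
    then obtain c where c: "P j = P i * c" by (elim dvdE)
    then have "is_unit c"
      using irreducibleD[OF irreducible[OF that(2)] c] P[OF that(1)] by (auto dest: prime_elem_not_unit)
    then obtain a where a: "c = [:a:]" by (auto simp: is_unit_poly_iff)
    then have "a = 1"
      using c monic[OF that(1)] monic[OF that(2)] by (cases "a = 0") auto
    with c a have "P i = P j" by (simp add: one_pCons [symmetric])
    with distinct that show False by (auto dest: inj_onD)
  qed
  have P0: "P i \<noteq> 0" if "i \<in> {1..r}" for i
    using pos_degree[OF that] by auto
  have f0: "f \<noteq> 0" and g0: "g \<noteq> 0" using f g by auto
  \<comment> \<open>The exponent of \<open>poly_abs (P i)\<close> in the count and the one in the
    denominator add up to its exponent in \<open>poly_abs g ^ q ^ n\<close>.\<close>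
  have expo: "(\<Sum>j\<in>{1..e i}. q ^ min (j * d i) n) + E i = e i * q ^ n" if "i \<in> {1..r}" for i
  proof -
    have "{1..n - 1} = {1..<n}" by auto
    then show ?thesis
      using sum_power_min_add[where q = q and d = "d i" and e = "e i" and n = n] pos_degree[OF that] d[OF that]
      by (simp add: E_def q Suc_leI)
  qed
  have "num_congruence_preserving f g = (\<Prod>i\<in>{1..r}. \<Prod>j\<in>{1..e i}. poly_abs (P i) ^ q ^ min (j * d i) n)"
    using card_cong_funs_prod[of "{1..r}" \<alpha> f P e] P ndvd f0 g0 \<alpha> d
    by (simp add: num_congruence_preserving_eq factorization q n)
  also have "\<dots> = (\<Prod>i\<in>{1..r}. poly_abs (P i) ^ (\<Sum>j\<in>{1..e i}. q ^ min (j * d i) n))"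
    by (simp add: power_sum)
  finally have "num_congruence_preserving f g =
      (\<Prod>i\<in>{1..r}. poly_abs (P i) ^ (\<Sum>j\<in>{1..e i}. q ^ min (j * d i) n))" .
  \<comment> \<open>The formula is first proved multiplied out over the naturals; the division is
    carried out at the end, by a nonzero denominator.\<close>
  then have "num_congruence_preserving f g * (\<Prod>i\<in>{1..r}. poly_abs (P i) ^ E i) =
      (\<Prod>i\<in>{1..r}. poly_abs (P i) ^ (e i * q ^ n))"
    by (simp only: prod.distrib [symmetric] power_add [symmetric]) (rule prod.cong, simp_all only: expo)
  also have "\<dots> = poly_abs g ^ q ^ n"
    using \<alpha> by (simp add: factorization poly_abs_smult poly_abs_prod poly_abs_power power_mult prod_power_distrib)
  finally have "real (num_congruence_preserving f g) * real (\<Prod>i\<in>{1..r}. poly_abs (P i) ^ E i) =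
      real (poly_abs g ^ q ^ n)"
    by (metis of_nat_mult)
  moreover have "(\<Prod>i\<in>{1..r}. poly_abs (P i) ^ E i) \<noteq> 0"
    using P0 by (simp add: poly_abs_eq_0_iff)
  ultimately show ?thesis
    unfolding E_def by (simp only: eq_divide_eq of_nat_eq_0_iff) simp
qed

end
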